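(* Let $G$ be a connected uniquely colorable graph with $\chi(G)=t\ge 3$. Then $sn(G)=t-1$.
   Context: Graphs are finite, undirected and simple. A graph $G$ with chromatic number $k$ is uniquely colorable if every proper $k$-coloring of $G$ induces the same partition of the vertex set into color classes (i.e. the partition is unique up to permutation of the colors). Let $G=(V,E)$ be a connected graph with chromatic number $\chi(G)=k\ge 2$. For $S\subset V$, a partial coloring on $G[S]$ is a proper coloring $\mathscr C_0$ of the induced subgraph $G[S]$ with colors from $\{1,\dots,k\}$ (not all colors need be used). It is a Sudoku coloring of $G$ if there is exactly one proper $k$-coloring $V\to\{1,\dots,k\}$ of $G$ whose restriction to $S$ is $\mathscr C_0$. The Sudoku number $sn(G)$ is the smallest $|S|$ such that $G[S]$ admits a Sudoku coloring of $G$. *)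

theory Defs
  imports "Graph_Theory.Graph_Theory" "HOL-Library.FuncSet"
begin

text \<open>
  A finite simple undirected graph is a symmetric loop-free digraph without parallel arcs
  (locale \<^locale>\<open>graph\<close>): each edge is a pair of opposite arcs. Colorings are extensional
  functions on the vertex set, so that equality of functions is equality of colorings.
\<close>

definition proper_colorings :: "('a, 'b) pre_digraph \<Rightarrow> nat \<Rightarrow> ('a \<Rightarrow> nat) set" where
  "proper_colorings G k =
     {c \<in> verts G \<rightarrow>\<^sub>E {1..k}. \<forall>u v. u \<rightarrow>\<^bsub>G\<^esub> v \<longrightarrow> c u \<noteq> c v}"

definition chromatic_number :: "('a, 'b) pre_digraph \<Rightarrow> nat" where
  "chromatic_number G = (LEAST k. proper_colorings G k \<noteq> {})"

definition color_classes :: "('a, 'b) pre_digraph \<Rightarrow> ('a \<Rightarrow> nat) \<Rightarrow> 'a set set" where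
  "color_classes G c = (\<lambda>i. {v \<in> verts G. c v = i}) ` (c ` verts G)"

definition uniquely_colorable :: "('a, 'b) pre_digraph \<Rightarrow> bool" where
  "uniquely_colorable G \<longleftrightarrow>
     (\<forall>c \<in> proper_colorings G (chromatic_number G).
      \<forall>d \<in> proper_colorings G (chromatic_number G). color_classes G c = color_classes G d)"

definition sudoku_coloring :: "('a, 'b) pre_digraph \<Rightarrow> 'a set \<Rightarrow> ('a \<Rightarrow> nat) \<Rightarrow> bool" where
  "sudoku_coloring G S c\<^sub>0 \<longleftrightarrow>
     c\<^sub>0 \<in> proper_colorings (G \<restriction> S) (chromatic_number G) \<and>
     (\<exists>!c. c \<in> proper_colorings G (chromatic_number G) \<and> restrict c S = c\<^sub>0)"

definition sudoku_number :: "('a, 'b) pre_digraph \<Rightarrow> nat" where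
  "sudoku_number G =
     (LEAST n. \<exists>S \<subseteq> verts G. card S = n \<and> (\<exists>c\<^sub>0. sudoku_coloring G S c\<^sub>0))"

end

theory Submission
  imports Defs
begin

text \<open>
  Fixing one vertex in all but one of the color classes determines the names of all classes. If
  fewer than \<open>t - 1\<close> vertices are precolored, two colors are unused there, and swapping them
  changes every coloring because all \<open>t\<close> colors occur.
\<close>

lemma proper_colorings_comp:
  assumes "c \<in> proper_colorings G k" "inj_on p (c ` verts G)" "p ` c ` verts G \<subseteq> {1..m}"
    and "wf_digraph G"
  shows "restrict (p \<circ> c) (verts G) \<in> proper_colorings G m"
proof -
  have "p (c u) \<noteq> p (c v)" if "u \<rightarrow>\<^bsub>G\<^esub> v" for u v
  proof -
    have "u \<in> verts G" "v \<in> verts G"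
      using that wf_digraph.adj_in_verts[OF assms(4)] by blast+
    moreover have "c u \<noteq> c v"
      using that assms(1) by (auto simp: proper_colorings_def)
    ultimately show ?thesis
      using assms(2) by (auto dest: inj_onD)
  qed
  then show ?thesis
    using assms(3) wf_digraph.adj_in_verts[OF assms(4)]
    by (auto simp: proper_colorings_def)
qed

text \<open>\<open>LEAST\<close> says something about \<open>chromatic_number\<close> only once some
  number of colors suffices. Numbering the vertices bijectively gives such a coloring, since
  adjacent vertices are distinct.\<close>

lemma proper_coloring_exists:
  assumes "graph G"
  shows "proper_colorings G (chromatic_number G) \<noteq> {}"
proof -
  interpret graph G by fact
  obtain f where f: "bij_betw f (verts G) {1..card (verts G)}"
    using ex_bij_betw_nat_finite_1[OF finite_verts] bij_betw_inv by blast
  have "f u \<noteq> f v" if "u \<rightarrow>\<^bsub>G\<^esub> v" for u v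
    using adj_in_verts[OF that] adj_not_same[of u] that f by (metis bij_betw_def inj_onD)
  then have "restrict f (verts G) \<in> proper_colorings G (card (verts G))"
    using f adj_in_verts by (auto simp: proper_colorings_def bij_betw_def)
  then show ?thesis
    unfolding chromatic_number_def
    by (intro LeastI[where P = "\<lambda>k. proper_colorings G k \<noteq> {}"]) auto
qed

text \<open>If a color were missing, it could replace the top color, and one color fewer would
  suffice, against minimality.\<close>

lemma proper_coloring_surj:
  assumes "wf_digraph G" "c \<in> proper_colorings G (chromatic_number G)"
  shows "c ` verts G = {1..chromatic_number G}"
proof (rule ccontr)
  let ?t = "chromatic_number G"
  have range: "c ` verts G \<subseteq> {1..?t}"
    using assms(2) by (auto simp: proper_colorings_def)
  assume "c ` verts G \<noteq> {1..?t}"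
  then obtain i where i: "i \<in> {1..?t}" "i \<notin> c ` verts G"
    using range by blast
  \<comment> \<open>Moves the top color \<open>?t\<close> into the gap \<open>i\<close>. If
    \<open>i = ?t\<close>, this is the identity, and \<open>?t\<close> does not occur
    anyway.\<close>
  define p where "p = (\<lambda>j. if j = ?t then i else j)"
  have "inj_on p (c ` verts G)"
    using i by (auto simp: inj_on_def p_def)
  moreover have "p ` c ` verts G \<subseteq> {1..?t - 1}"
  proof
    fix y assume "y \<in> p ` c ` verts G"
    then obtain j where j: "j \<in> c ` verts G" "y = p j" by blast
    have "j \<in> {1..?t}" "j \<noteq> i" using j(1) range i by blast+
    then show "y \<in> {1..?t - 1}"
      using i(1) j(2) by (cases "j = ?t") (auto simp: p_def)
  qed
  ultimately have "proper_colorings G (?t - 1) \<noteq> {}"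
    using proper_colorings_comp[OF assms(2) _ _ assms(1)] by blast
  \<comment> \<open>Strict despite truncated subtraction: the missing color \<open>i\<close>
    witnesses that \<open>?t\<close> is positive.\<close>
  moreover have "?t - 1 < ?t"
    using i(1) by auto
  ultimately show False
    using not_less_Least unfolding chromatic_number_def by blast
qed

text \<open>Makes equality of partitions usable vertex by vertex: the class of \<open>v\<close>
  under \<open>c\<close> is some class of \<open>d\<close>, and as it contains \<open>v\<close>, its
  color there is \<open>d v\<close>.\<close>

lemma color_classes_eqD:
  assumes "color_classes G c = color_classes G d" "u \<in> verts G" "v \<in> verts G"
  shows "c u = c v \<longleftrightarrow> d u = d v"
proof -
  have "{w \<in> verts G. c w = c v} \<in> color_classes G d"
    using assms by (auto simp: color_classes_def)
  then obtain j where j: "{w \<in> verts G. c w = c v} = {w \<in> verts G. d w = j}"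
    by (auto simp: color_classes_def)
  then have "d v = j"
    using assms(3) by blast
  then show ?thesis
    using j assms(2) by blast
qed

lemma sudoku_coloring_card_ge:
  assumes "graph G" "S \<subseteq> verts G" "sudoku_coloring G S c\<^sub>0"
  shows "chromatic_number G - 1 \<le> card S"
proof (rule ccontr)
  interpret graph G by fact
  let ?t = "chromatic_number G"
  assume less: "\<not> ?t - 1 \<le> card S"
  obtain c where c: "c \<in> proper_colorings G ?t" "restrict c S = c\<^sub>0"
    and uniq: "\<And>d. d \<in> proper_colorings G ?t \<Longrightarrow> restrict d S = c\<^sub>0 \<Longrightarrow> d = c"
    using assms(3) unfolding sudoku_coloring_def by blast
  note surj = proper_coloring_surj[OF wf_digraph_axioms c(1)]
  have "finite S"
    using assms(2) finite_verts finite_subset by blast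
  then have "card (c ` S) \<le> card S" "finite (c ` S)"
    by (auto intro: card_image_le)
  moreover have "card {1..?t} - card (c ` S) \<le> card ({1..?t} - c ` S)"
    using \<open>finite (c ` S)\<close> by (rule diff_card_le_card_Diff)
  \<comment> \<open>The precolored vertices show at most \<open>card S < ?t - 1\<close>
    colors.\<close>
  ultimately have "2 \<le> card ({1..?t} - c ` S)"
    using less by simp
  then have "\<not> card ({1..?t} - c ` S) \<le> Suc 0"
    by linarith
  then obtain a b where ab: "a \<in> {1..?t} - c ` S" "b \<in> {1..?t} - c ` S" "a \<noteq> b"
    using card_le_Suc0_iff_eq[of "{1..?t} - c ` S"] by blast
  let ?p = "Transposition.transpose a b"
  let ?d = "restrict (?p \<circ> c) (verts G)"
  have "?p ` c ` verts G \<subseteq> {1..?t}"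
    using ab surj by (auto simp: transpose_def)
  then have "?d \<in> proper_colorings G ?t"
    by (intro proper_colorings_comp[OF c(1) _ _ wf_digraph_axioms])
       (auto intro: inj_on_subset[OF inj_transpose])
  moreover have "restrict ?d S = c\<^sub>0"
  proof -
    have "c v \<noteq> a" "c v \<noteq> b" if "v \<in> S" for v
      using ab that by blast+
    then have "restrict ?d S = restrict c S"
      using assms(2) by (auto simp: restrict_def fun_eq_iff)
    then show ?thesis using c(2) by simp
  qed
  ultimately have "?d = c"
    by (rule uniq)
  \<comment> \<open>Color \<open>a\<close> is absent from \<open>S\<close> but present in
    \<open>G\<close>, so the swap changes the color of some vertex to \<open>b\<close>.\<close>
  moreover obtain v where "v \<in> verts G" "c v = a"
    using ab(1) surj by (metis DiffD1 imageE)
  ultimately show False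
    using ab(3) by (metis comp_apply restrict_apply' transpose_apply_first)
qed

text \<open>\<open>S\<close> holds one representative of each class with color below
  \<open>chromatic_number G\<close>; the top color is then forced on the one class left
  over.\<close>

lemma uniquely_colorable_sudoku_coloring:
  assumes "graph G" "uniquely_colorable G"
  obtains S c\<^sub>0 where "S \<subseteq> verts G" "card S = chromatic_number G - 1" "sudoku_coloring G S c\<^sub>0"
proof -
  interpret graph G by fact
  let ?t = "chromatic_number G"
  obtain c where c: "c \<in> proper_colorings G ?t"
    using proper_coloring_exists[OF assms(1)] by blast
  have "\<forall>i\<in>{1..?t - 1}. \<exists>v\<in>verts G. c v = i"
  proof
    fix i assume "i \<in> {1..?t - 1}"
    then have "i \<in> c ` verts G"
      unfolding proper_coloring_surj[OF wf_digraph_axioms c] by auto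
    then show "\<exists>v\<in>verts G. c v = i" by blast
  qed
  then obtain f where f: "\<And>i. i \<in> {1..?t - 1} \<Longrightarrow> f i \<in> verts G \<and> c (f i) = i"
    by metis
  define S where "S = f ` {1..?t - 1}"
  have sub: "S \<subseteq> verts G"
    using f by (auto simp: S_def)
  \<comment> \<open>On these colors \<open>c\<close> is a left inverse of \<open>f\<close>.\<close>
  have "inj_on f {1..?t - 1}"
    using f by (metis inj_onI)
  then have "card S = ?t - 1"
    by (simp add: S_def card_image)
  moreover have "sudoku_coloring G S (restrict c S)"
  proof -
    have "restrict c S \<in> proper_colorings (G \<restriction> S) ?t"
    proof -
      have "u \<in> S \<and> v \<in> S \<and> u \<rightarrow>\<^bsub>G\<^esub> v" if "u \<rightarrow>\<^bsub>G \<restriction> S\<^esub> v" for u v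
        using that by (auto simp: arcs_ends_def arc_to_ends_def)
      then show ?thesis
        using c sub by (fastforce simp: proper_colorings_def)
    qed
    moreover have "d = c" if d: "d \<in> proper_colorings G ?t" "restrict d S = restrict c S" for d
    proof
      have "color_classes G c = color_classes G d"
        using assms(2) c d(1) unfolding uniquely_colorable_def by blast
      note same = color_classes_eqD[OF this]
      have df: "d (f i) = i" if "i \<in> {1..?t - 1}" for i
      proof -
        have "f i \<in> S"
          using that by (simp add: S_def)
        then show ?thesis
          using fun_cong[OF d(2), of "f i"] f[OF that] by simp
      qed
      fix v
      show "d v = c v"
      proof (cases "v \<in> verts G")
        \<comment> \<open>Extensionality: both colorings are \<open>undefined\<close> outside the
          vertex set.\<close>
        case False
        then show ?thesis
          using c d(1) by (auto simp: proper_colorings_def PiE_def extensional_def)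
      next
        case True
        have range: "c v \<in> {1..?t}" "d v \<in> {1..?t}"
          using c d(1) True by (auto simp: proper_colorings_def)
        \<comment> \<open>Either side says that \<open>v\<close> lies in the class of the
          representative \<open>f i\<close>, and \<open>c\<close> and \<open>d\<close> have the same
          classes and agree on \<open>f i\<close>.\<close>
        have eq: "d v = i \<longleftrightarrow> c v = i" if "i \<in> {1..?t - 1}" for i
          using same[OF True, of "f i"] f[OF that] df[OF that] by simp
        show ?thesis
        \<comment> \<open>Unless both values are the top color, one of them is below it and
          \<open>eq\<close> gives the other.\<close>
        proof (cases "c v = ?t \<and> d v = ?t")
          case False
          then have "c v \<in> {1..?t - 1} \<or> d v \<in> {1..?t - 1}"
            using range by auto
          then show ?thesis
          proof
            assume "c v \<in> {1..?t - 1}"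
            from eq[OF this] show ?thesis by (rule iffD2) (rule refl)
          next
            assume "d v \<in> {1..?t - 1}"
            from eq[OF this] have "c v = d v" by (rule iffD1) (rule refl)
            then show ?thesis by (rule sym)
          qed
        qed simp
      qed
    qed
    ultimately show ?thesis
      unfolding sudoku_coloring_def by (intro conjI ex1I[of _ c]) (simp_all add: c)
  qed
  ultimately show thesis
    by (rule that[OF sub])
qed

theorem theorem3p3:
  fixes G :: "('a, 'b) pre_digraph" and t :: nat
  assumes "graph G"
    and "connected G"
    and "uniquely_colorable G"
    and "chromatic_number G = t"
    and "t \<ge> 3"
  shows "sudoku_number G = t - 1"
  unfolding sudoku_number_def
proof (rule Least_equality)
  show "\<exists>S \<subseteq> verts G. card S = t - 1 \<and> (\<exists>c\<^sub>0. sudoku_coloring G S c\<^sub>0)"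
    using uniquely_colorable_sudoku_coloring[OF assms(1,3)] assms(4) by metis
next
  fix n
  assume "\<exists>S \<subseteq> verts G. card S = n \<and> (\<exists>c\<^sub>0. sudoku_coloring G S c\<^sub>0)"
  then show "t - 1 \<le> n"
    using sudoku_coloring_card_ge[OF assms(1)] assms(4) by blast
qed

end
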